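(* For any $\alpha\in(1,2]$, $c>0$ and $\nu\ge1$, there exists no algorithm that guarantees, up to multiplicative log-factors in $\|\boldsymbol w\|$ and $T$, a bound on the regret $\sum_{t=1}^T\langle\boldsymbol g_t,\widehat{\boldsymbol w}_t-\boldsymbol w\rangle$ of the form $$c\cdot\left(L_T\|\boldsymbol w\|^\nu+L_T^{1-\alpha/2}(\|\boldsymbol w\|+1)\sqrt{V_{\alpha,T}\ln T}\right)$$ for all $T\ge1$, $\boldsymbol w\in\mathbb R^d$ and $(\boldsymbol g_t)\subset\mathbb R^d$, where $V_{\alpha,T}:=\sum_{t=1}^T\|\boldsymbol g_t\|^\alpha$ and $L_T:=\max_{t\le T}\|\boldsymbol g_t\|$.
   Context: $\|\cdot\|$ is the Euclidean norm on $\mathbb R^d$. The setting is online linear (convex) optimization on the unbounded domain $\mathbb R^d$ without hints: in each round $t\ge1$ the algorithm outputs $\widehat{\boldsymbol w}_t\in\mathbb R^d$ based only on the previously observed (sub-gradient) vectors $\boldsymbol g_1,\dots,\boldsymbol g_{t-1}$, without prior knowledge of $T$, of the comparator $\boldsymbol w$, or of any bound on the norms $\|\boldsymbol g_t\|$; then $\boldsymbol g_t\in\mathbb R^d$ is revealed. The regret after $T$ rounds against the comparator $\boldsymbol w$ is the linearized regret $\sum_{t=1}^T\langle\boldsymbol g_t,\widehat{\boldsymbol w}_t-\boldsymbol w\rangle$. *)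

theory Defs
  imports "HOL-Analysis.Analysis"
begin

text \<open>A (deterministic) online algorithm is a map from the finite history of observed vectors to
  the next output. Rounds are numbered from 1.\<close>

type_synonym 'a online_algorithm = "'a list \<Rightarrow> 'a"

definition prediction :: "'a online_algorithm \<Rightarrow> (nat \<Rightarrow> 'a) \<Rightarrow> nat \<Rightarrow> 'a" where
  "prediction A g t = A (map g [1..<t])"

definition regret ::
    "'a::real_inner online_algorithm \<Rightarrow> (nat \<Rightarrow> 'a) \<Rightarrow> nat \<Rightarrow> 'a \<Rightarrow> real" where
  "regret A g T w = (\<Sum>t=1..T. g t \<bullet> (prediction A g t - w))"

definition L_max :: "(nat \<Rightarrow> 'a::real_normed_vector) \<Rightarrow> nat \<Rightarrow> real" where
  "L_max g T = Max ((\<lambda>t. norm (g t)) ` {1..T})"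

definition V_sum :: "real \<Rightarrow> (nat \<Rightarrow> 'a::real_normed_vector) \<Rightarrow> nat \<Rightarrow> real" where
  "V_sum \<alpha> g T = (\<Sum>t=1..T. norm (g t) powr \<alpha>)"

text \<open>A multiplicative logarithmic factor in \<open>x = \<parallel>w\<parallel>\<close> and \<open>T\<close>: a quantity depending on nothing else
  and at most polylogarithmic in the two. The shifts by 1 keep both bases at least 1, so that
  natural exponents also cover fractional powers of logarithms; joint factors such as powers of
  \<open>ln (2 + x * T)\<close> are covered as well.\<close>

definition log_factor :: "(real \<Rightarrow> nat \<Rightarrow> real) \<Rightarrow> bool" where
  "log_factor \<phi> \<longleftrightarrow>
     (\<exists>K p q. \<forall>x\<ge>0. \<forall>T\<ge>1.
        0 \<le> \<phi> x T \<and> \<phi> x T \<le> K * (1 + ln (1 + x)) ^ p * (1 + ln (real T)) ^ q)"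

end

theory Submission
  imports Defs "HOL-Real_Asymp.Real_Asymp"
begin

text \<open>Feed the algorithm the constant gradient \<open>- e\<close> for a unit vector \<open>e\<close>. Competing with
  \<open>w = x e\<close>, where \<open>x = T powr (1 / (2 \<nu>))\<close> makes the term \<open>\<parallel>w\<parallel>\<^sup>\<nu>\<close> equal to \<open>\<surd>T\<close>, forces the
  predictions to reach \<open>x / 2\<close> in the direction \<open>e\<close> within \<open>T\<close> rounds. In the first round where this
  happens, replace the gradient by \<open>2 T e\<close>: it dominates both \<open>L\<close> and \<open>V\<close>, and the earlier gains are at
  most \<open>T x / 2\<close>, so the regret against \<open>0\<close> is at least \<open>T x / 2\<close>, whereas the claimed bound allows only
  \<open>T\<close> times a power of \<open>ln T\<close>.\<close>

lemma prediction_cong: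
  assumes "\<And>s. 1 \<le> s \<Longrightarrow> s < t \<Longrightarrow> g s = h s"
  shows "prediction A g t = prediction A h t"
  unfolding prediction_def by (rule arg_cong[of _ _ A]) (simp add: assms)

text \<open>Every comparator used below has norm at most \<open>T\<close>, so
  \<open>ln (1 + x)\<close> is itself of order \<open>1 + ln T\<close>, and the two logarithmic
  factors merge into a single power of \<open>1 + ln T\<close>.\<close>

lemma log_factor_poly_ln:
  assumes "log_factor \<phi>"
  obtains C n where "C \<ge> 0"
    and "\<And>x T. \<lbrakk>T \<ge> 1; 0 \<le> x; x \<le> real T\<rbrakk> \<Longrightarrow> 0 \<le> \<phi> x T"
    and "\<And>x T. \<lbrakk>T \<ge> 1; 0 \<le> x; x \<le> real T\<rbrakk> \<Longrightarrow> \<phi> x T \<le> C * (1 + ln (real T)) ^ n"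
proof -
  from assms obtain K p q where K: "\<And>x T. x \<ge> 0 \<Longrightarrow> T \<ge> 1 \<Longrightarrow>
      0 \<le> \<phi> x T \<and> \<phi> x T \<le> K * (1 + ln (1 + x)) ^ p * (1 + ln (real T)) ^ q"
    unfolding log_factor_def by blast
  have "\<phi> x T \<le> (\<bar>K\<bar> * 2 ^ p) * (1 + ln (real T)) ^ (p + q)"
    if "T \<ge> 1" "0 \<le> x" "x \<le> real T" for x T
  proof -
    have "ln (1 + x) \<le> ln (2 * real T)"
      using that by simp
    also have "\<dots> \<le> 1 + ln (real T)"
      using that ln_2_less_1 by (simp add: ln_mult)
    also have "\<dots> \<le> 1 + 2 * ln (real T)"
      using that by simp
    finally have "1 + ln (1 + x) \<le> 2 * (1 + ln (real T))"
      by simp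
    then have "(1 + ln (1 + x)) ^ p \<le> (2 * (1 + ln (real T))) ^ p"
      using that by (intro power_mono) auto
    then have "K * (1 + ln (1 + x)) ^ p * (1 + ln (real T)) ^ q
        \<le> \<bar>K\<bar> * (2 * (1 + ln (real T))) ^ p * (1 + ln (real T)) ^ q"
      using that by (intro mult_right_mono mult_mono) auto
    also have "\<dots> = (\<bar>K\<bar> * 2 ^ p) * (1 + ln (real T)) ^ (p + q)"
      by (simp only: power_mult_distrib power_add mult_ac)
    finally show ?thesis
      using K[of x T] that by linarith
  qed
  with K show ?thesis
    by (intro that[of "\<bar>K\<bar> * 2 ^ p" "p + q"]) auto
qed

lemma eventually_poly_ln_less_powr:
  fixes C b :: real
  assumes "b > 0"
  shows "\<forall>\<^sub>F T in sequentially. C * (1 + ln (real T)) ^ n < real T powr b"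
proof -
  have "(\<lambda>T. (1 + ln (real T)) ^ n) \<in> o(\<lambda>T. real T powr b)"
    using assms by real_asymp
  \<comment> \<open>The constant \<open>\<bar>C\<bar> + 1\<close> is positive and exceeds
    \<open>C\<close>; the excess yields the strict inequality.\<close>
  then have "\<forall>\<^sub>F T in sequentially. norm ((1 + ln (real T)) ^ n) \<le> 1 / (\<bar>C\<bar> + 1) * norm (real T powr b)"
    by (rule landau_o.smallD) simp
  then show ?thesis
    using eventually_gt_at_top[of 0]
  proof eventually_elim
    case (elim T)
    let ?l = "1 + ln (real T)"
    have l: "?l > 0"
      using elim by (simp add: add_pos_nonneg)
    then have "C * ?l ^ n < (\<bar>C\<bar> + 1) * ?l ^ n"
      by (intro mult_strict_right_mono) auto
    also have "\<dots> \<le> real T powr b"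
      using elim l by (simp add: field_simps)
    finally show ?case .
  qed
qed

lemma regret_constant_gradient:
  assumes "norm e = 1"
  shows "regret A (\<lambda>_. - e) T (x *\<^sub>R e) = T * x - (\<Sum>t=1..T. e \<bullet> prediction A (\<lambda>_. - e) t)"
  using assms
  by (simp add: regret_def inner_diff_right sum_subtractf sum_negf dot_square_norm)

text \<open>The spike costs at least \<open>2 * T * y\<close>, while each of the fewer than
  \<open>T\<close> earlier rounds gains at most \<open>y\<close>. Half of the spike thus pays for
  all earlier gains.\<close>

lemma regret_spike_ge:
  assumes "norm e = 1" "1 \<le> \<tau>" "\<tau> \<le> T" "0 \<le> y"
    and small: "\<And>s. 1 \<le> s \<Longrightarrow> s < \<tau> \<Longrightarrow> e \<bullet> prediction A (\<lambda>_. - e) s \<le> y"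
    and large: "y \<le> e \<bullet> prediction A (\<lambda>_. - e) \<tau>"
  shows "T * y \<le> regret A (\<lambda>s. if s = \<tau> then (2 * real T) *\<^sub>R e else - e) \<tau> 0"
proof -
  let ?g = "\<lambda>s. if s = \<tau> then (2 * real T) *\<^sub>R e else - e"
  \<comment> \<open>The case \<open>s = \<tau>\<close> is included: the output of round
    \<open>\<tau>\<close> depends on earlier gradients only, so the spike comes too late to affect
    it.\<close>
  have same: "prediction A ?g s = prediction A (\<lambda>_. - e) s" if "s \<le> \<tau>" for s
    using that by (intro prediction_cong) auto
  have "{1..\<tau>} = insert \<tau> {1..<\<tau>}"
    using assms by auto
  then have "regret A ?g \<tau> 0 = 2 * T * (e \<bullet> prediction A (\<lambda>_. - e) \<tau>)
      - (\<Sum>s\<in>{1..<\<tau>}. e \<bullet> prediction A (\<lambda>_. - e) s)"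
    by (simp add: regret_def same sum_negf)
  moreover have "(\<Sum>s\<in>{1..<\<tau>}. e \<bullet> prediction A (\<lambda>_. - e) s) \<le> (\<Sum>s\<in>{1..<\<tau>}. y)"
    by (intro sum_mono small) auto
  moreover have "(\<Sum>s\<in>{1..<\<tau>}. y) \<le> T * y"
    using assms by (auto intro!: mult_right_mono)
  moreover have "2 * T * y \<le> 2 * T * (e \<bullet> prediction A (\<lambda>_. - e) \<tau>)"
    using large by (intro mult_left_mono) auto
  ultimately show ?thesis
    by linarith
qed

text \<open>Since \<alpha> \<ge> 1, the term \<open>(2 * T) powr \<alpha>\<close> of the spike
  outweighs the sum over the unit gradients. The exponents \<open>1 - \<alpha> / 2\<close> and
  \<open>\<alpha> / 2\<close> then add up to 1, so the bound is linear in \<open>T\<close> whatever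
  \<alpha> is.\<close>

lemma spike_bound_le:
  assumes "norm e = 1" "1 \<le> \<tau>" "\<tau> \<le> T" "1 \<le> \<alpha>"
  defines "g \<equiv> \<lambda>s. if s = \<tau> then (2 * real T) *\<^sub>R e else - e"
  shows "L_max g \<tau> powr (1 - \<alpha> / 2) * sqrt (V_sum \<alpha> g \<tau> * ln \<tau>) \<le> 2 * real T * (1 + ln T)"
proof -
  have T: "1 \<le> real T" "1 \<le> real \<tau>" "real \<tau> \<le> real T"
    using assms by auto
  have L: "L_max g \<tau> = 2 * real T"
    unfolding L_max_def using assms T by (intro Max_eqI) (auto simp: g_def)
  have "{1..\<tau>} = insert \<tau> {1..<\<tau>}"
    using assms by auto
  then have "V_sum \<alpha> g \<tau> = (2 * real T) powr \<alpha> + real (\<tau> - 1)"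
    using assms by (simp add: V_sum_def g_def)
  also have "real (\<tau> - 1) \<le> (2 * real T) powr 1"
    using T by simp
  also have "\<dots> \<le> (2 * real T) powr \<alpha>"
    using T assms by (intro powr_mono) auto
  finally have "V_sum \<alpha> g \<tau> \<le> 2 * (2 * real T) powr \<alpha>"
    by simp
  moreover have "ln \<tau> \<le> ln T"
    using T by simp
  ultimately have "V_sum \<alpha> g \<tau> * ln \<tau> \<le> (2 * (2 * real T) powr \<alpha>) * ln T"
    using T by (intro mult_mono) auto
  then have "sqrt (V_sum \<alpha> g \<tau> * ln \<tau>) \<le> sqrt ((2 * real T) powr \<alpha> * (2 * ln T))"
    by (simp add: mult_ac)
  also have "\<dots> = (2 * real T) powr (\<alpha> / 2) * sqrt (2 * ln T)"
    using T by (simp add: real_sqrt_mult powr_half_sqrt[symmetric] powr_powr)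
  \<comment> \<open>Expand \<open>(1 + u)^2 = 1 + 2 * u + u^2\<close> with
    \<open>u = ln T\<close>.\<close>
  also have "sqrt (2 * ln T) \<le> 1 + ln T"
    using T by (intro real_le_lsqrt) (auto simp: power2_eq_square algebra_simps)
  finally have "L_max g \<tau> powr (1 - \<alpha> / 2) * sqrt (V_sum \<alpha> g \<tau> * ln \<tau>)
      \<le> (2 * real T) powr (1 - \<alpha> / 2) * ((2 * real T) powr (\<alpha> / 2) * (1 + ln T))"
    unfolding L by (simp add: mult_left_mono)
  also have "\<dots> = 2 * real T * (1 + ln T)"
    using T by (simp add: powr_add[symmetric] mult.assoc[symmetric])
  finally show ?thesis .
qed

theorem theorem14:
  fixes \<alpha> c \<nu> :: real
  assumes "1 < \<alpha>" and "\<alpha> \<le> 2" and "c > 0" and "\<nu> \<ge> 1"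
  shows "\<not> (\<exists>(A :: (real ^ 'd) online_algorithm) \<phi>. log_factor \<phi> \<and>
           (\<forall>T\<ge>1. \<forall>w g.
              regret A g T w
                \<le> \<phi> (norm w) T *
                   (c * (L_max g T * norm w powr \<nu>
                       + L_max g T powr (1 - \<alpha> / 2) * (norm w + 1)
                           * sqrt (V_sum \<alpha> g T * ln (real T))))))"
proof (intro notI, elim exE conjE)
  fix A :: "(real ^ 'd) online_algorithm" and \<phi>
  assume "log_factor \<phi>" and "\<forall>T\<ge>1. \<forall>w g. regret A g T w \<le> \<phi> (norm w) T *
      (c * (L_max g T * norm w powr \<nu> + L_max g T powr (1 - \<alpha> / 2) * (norm w + 1)
        * sqrt (V_sum \<alpha> g T * ln (real T))))"
  then have bound: "regret A g T w \<le> \<phi> (norm w) T *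
      (c * (L_max g T * norm w powr \<nu> + L_max g T powr (1 - \<alpha> / 2) * (norm w + 1)
        * sqrt (V_sum \<alpha> g T * ln (real T))))" if "T \<ge> 1" for T w g
    using that by blast
  from \<open>log_factor \<phi>\<close> obtain C n where "C \<ge> 0"
    and \<phi>_nonneg: "\<And>x T. \<lbrakk>T \<ge> 1; 0 \<le> x; x \<le> real T\<rbrakk> \<Longrightarrow> 0 \<le> \<phi> x T"
    and \<phi>_le: "\<And>x T. \<lbrakk>T \<ge> 1; 0 \<le> x; x \<le> real T\<rbrakk> \<Longrightarrow> \<phi> x T \<le> C * (1 + ln (real T)) ^ n"
    by (rule log_factor_poly_ln) blast
  define b where "b = 1 / (2 * \<nu>)"
  have b: "0 < b" "b \<le> 1 / 2" "b * \<nu> = 1 / 2"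
    using assms by (auto simp: b_def field_simps)
  \<comment> \<open>Of the \<open>Suc n\<close> logarithms, \<open>n\<close> come from
    \<open>\<phi>\<close> and one from the square root in the bound. In the notation below, the
    first phase needs \<open>x > 6 * P * l\<close> and the spike needs \<open>x > 4 * P * l\<close>;
    the constant 8 covers both.\<close>
  have "\<forall>\<^sub>F T in sequentially. 8 * c * C * (1 + ln (real T)) ^ Suc n < real T powr b \<and> T \<ge> 1"
    using eventually_poly_ln_less_powr[OF b(1)] eventually_ge_at_top by (rule eventually_conj)
  then obtain T where big: "8 * c * C * (1 + ln (real T)) ^ Suc n < real T powr b" and "T \<ge> 1"
    by (auto dest: eventually_happens)
  define x where "x = real T powr b"
  define l where "l = 1 + ln (real T)"
  define P where "P = c * C * l ^ n"
  have T: "real T \<ge> 1" and l: "l \<ge> 1"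
    using \<open>T \<ge> 1\<close> by (auto simp: l_def)
  have "P \<ge> 0"
    using assms \<open>C \<ge> 0\<close> l by (simp add: P_def)
  have x_big: "8 * (P * l) < x"
    using big by (simp add: x_def P_def l_def mult_ac)
  \<comment> \<open>This is where \<nu> \<ge> 1 enters, through \<open>b \<le> 1 / 2\<close>. It
    gives \<open>x \<le> T\<close>, as the estimate of \<open>\<phi>\<close> requires, and lets
    \<open>sqrt T\<close> dominate \<open>P * l\<close> as well.\<close>
  have "x \<le> real T powr (1 / 2)"
    unfolding x_def using T b by (intro powr_mono) auto
  then have x_le_sqrt: "x \<le> sqrt T"
    by (simp add: powr_half_sqrt)
  have "sqrt T \<le> sqrt T * sqrt T"
    using T by (simp del: real_sqrt_mult_self)
  then have "x \<le> T"
    using x_le_sqrt by simp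
  have "x \<ge> 1"
    using T b by (simp add: x_def ge_one_powr_ge_zero)
  have x_powr: "x powr \<nu> = sqrt T"
    unfolding x_def powr_powr b(3) by (simp add: powr_half_sqrt)
  obtain e :: "real ^ 'd" where e: "norm e = 1"
    using vector_choose_size[of 1] by auto
  let ?h = "\<lambda>_::nat. - e"

  \<comment> \<open>Otherwise the regret against \<open>x *\<^sub>R e\<close> is at least
    \<open>T * x / 2\<close>, whereas with \<open>L = 1\<close> and \<open>V = T\<close> the claimed
    bound is only \<open>x * sqrt T\<close> up to logarithms.\<close>
  have "\<exists>t\<in>{1..T}. x / 2 \<le> e \<bullet> prediction A ?h t"
  proof (rule ccontr)
    assume "\<not> ?thesis"
    then have "(\<Sum>t=1..T. e \<bullet> prediction A ?h t) \<le> (\<Sum>t=1..T. x / 2)"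
      by (intro sum_mono) (meson linorder_le_cases)
    then have "T * x / 2 \<le> regret A ?h T (x *\<^sub>R e)"
      using regret_constant_gradient[OF e] by (simp add: mult.commute)
    also have "\<dots> \<le> \<phi> x T * (c * (x powr \<nu> + (x + 1) * sqrt (T * ln T)))"
    proof -
      have "{1..T} \<noteq> {}" and "norm (x *\<^sub>R e) = x"
        using \<open>T \<ge> 1\<close> \<open>x \<ge> 1\<close> e by auto
      then show ?thesis
        using bound[OF \<open>T \<ge> 1\<close>, of ?h "x *\<^sub>R e"] e
        by (simp add: L_max_def V_sum_def image_constant_conv)
    qed
    \<comment> \<open>The 3 splits as 2 + 1: \<open>x + 1 \<le> 2 * x\<close> in the second summand,
      and \<open>x powr \<nu> = sqrt T\<close> for the first.\<close>
    also have "\<dots> \<le> C * l ^ n * (c * (3 * x * sqrt T * l))"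
    proof -
      have "sqrt (ln T) \<le> l"
        using T by (intro real_le_lsqrt) (auto simp: l_def power2_eq_square algebra_simps)
      then have "(x + 1) * sqrt (T * ln T) \<le> (2 * x) * (sqrt T * l)"
        unfolding real_sqrt_mult using \<open>x \<ge> 1\<close> T by (intro mult_mono) auto
      moreover have "1 * (sqrt T * 1) \<le> x * (sqrt T * l)"
        using \<open>x \<ge> 1\<close> l by (intro mult_mono) auto
      ultimately have "x powr \<nu> + (x + 1) * sqrt (T * ln T) \<le> 3 * x * sqrt T * l"
        by (simp add: x_powr)
      moreover have "\<phi> x T \<le> C * l ^ n"
        using \<phi>_le[of T x] \<open>T \<ge> 1\<close> \<open>x \<ge> 1\<close> \<open>x \<le> T\<close> by (simp add: l_def)
      ultimately show ?thesis
        using assms \<open>C \<ge> 0\<close> l T \<open>x \<ge> 1\<close> by (intro mult_mono) auto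
    qed
    also have "\<dots> = 3 * (P * l) * (x * sqrt T)"
      by (simp add: P_def)
    also have "\<dots> < 3 / 8 * sqrt T * (x * sqrt T)"
      using x_big x_le_sqrt \<open>x \<ge> 1\<close> T by (intro mult_strict_right_mono) auto
    also have "\<dots> = 3 / 8 * (T * x)"
      by simp
    finally have "T * x < 0"
      by linarith
    then show False
      using T \<open>x \<ge> 1\<close> by (simp add: mult_less_0_iff)
  qed
  then have ex: "\<exists>t. t \<in> {1..T} \<and> x / 2 \<le> e \<bullet> prediction A ?h t"
    by blast
  define \<tau> where "\<tau> = (LEAST t. t \<in> {1..T} \<and> x / 2 \<le> e \<bullet> prediction A ?h t)"
  have \<tau>: "1 \<le> \<tau>" "\<tau> \<le> T" "x / 2 \<le> e \<bullet> prediction A ?h \<tau>"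
    using LeastI_ex[OF ex] by (auto simp: \<tau>_def)
  have before: "e \<bullet> prediction A ?h s \<le> x / 2" if "1 \<le> s" "s < \<tau>" for s
    using that \<tau>(2) not_less_Least[of s "\<lambda>t. t \<in> {1..T} \<and> x / 2 \<le> e \<bullet> prediction A ?h t"]
    by (auto simp: \<tau>_def)

  let ?g = "\<lambda>s. if s = \<tau> then (2 * real T) *\<^sub>R e else - e"
  have "T * (x / 2) \<le> regret A ?g \<tau> 0"
    using e \<tau> before \<open>x \<ge> 1\<close> by (intro regret_spike_ge) auto
  \<comment> \<open>The guarantee is invoked with horizon \<open>\<tau>\<close> instead of
    \<open>T\<close>, so the game stops right at the spike. For comparator 0 the first summand
    vanishes, since \<open>0 powr \<nu> = 0\<close>.\<close>
  also have "\<dots> \<le> \<phi> 0 \<tau> * (c * (L_max ?g \<tau> powr (1 - \<alpha> / 2) * sqrt (V_sum \<alpha> ?g \<tau> * ln \<tau>)))"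
    using bound[OF \<tau>(1), of ?g 0] by simp
  also have "\<dots> \<le> \<phi> 0 \<tau> * (c * (2 * real T * l))"
    unfolding l_def using assms e \<tau> \<phi>_nonneg[of \<tau> 0]
    by (intro mult_left_mono spike_bound_le) auto
  also have "\<dots> \<le> C * l ^ n * (c * (2 * real T * l))"
  proof -
    have "\<phi> 0 \<tau> \<le> C * (1 + ln \<tau>) ^ n"
      using \<phi>_le[of \<tau> 0] \<tau> by simp
    also have "\<dots> \<le> C * l ^ n"
      unfolding l_def using \<tau> \<open>C \<ge> 0\<close> by (intro mult_left_mono power_mono) auto
    finally show ?thesis
      using assms l by (intro mult_right_mono) auto
  qed
  also have "\<dots> = T * (2 * (P * l))"
    by (simp add: P_def)
  finally have "x / 2 \<le> 2 * (P * l)"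
    using T by simp
  moreover have "P * l \<ge> 0"
    using \<open>P \<ge> 0\<close> l by simp
  ultimately show False
    using x_big \<open>x \<ge> 1\<close> by linarith
qed

end
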